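(* If $k \ge 2$ is an integer and $T$ is a tree of order $n$ and leaf order $\ell$, then $$\iota_k(T) \leq \frac{n + \ell}{2k+1}.$$
   Context: Graphs are finite and simple. A leaf is a vertex of degree $1$; the leaf order is the number of leaves; the order is the number of vertices. For $D\subseteq V(G)$, $N[D]$ is the set consisting of the vertices of $D$ and all their neighbours. For $k\ge 1$, a $k$-isolating set of $G$ is a set $D\subseteq V(G)$ (possibly empty) such that $G-N[D]$ contains no subgraph isomorphic to $K_{1,k}$ (equivalently, the maximum degree of $G-N[D]$ is at most $k-1$). The $k$-isolation number $\iota_k(G)$ is the size of a smallest $k$-isolating set of $G$. *)

theory Defs
  imports Complex_Main "Graph_Theory.Graph_Theory"
begin

text \<open>
  A finite simple graph is rendered by the locale \<open>graph\<close>: a finite, loop-free, symmetric digraph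
  without parallel arcs, in which an edge \<open>uv\<close> is the pair of arcs \<open>u \<rightarrow> v\<close>, \<open>v \<rightarrow> u\<close>.
  In such a digraph \<open>u, v, u\<close> is a \<open>cycle\<close>, so the library predicate \<open>Digraph_Component.tree\<close> does
  not describe undirected trees. The cycles with at least three arcs are exactly the cycles of
  the underlying simple graph. The predicate \<open>connected\<close> excludes the empty graph.
\<close>

definition undirected_tree :: "('a, 'b) pre_digraph \<Rightarrow> bool" where
  "undirected_tree G \<longleftrightarrow>
     graph G \<and> connected G \<and> \<not> (\<exists>p. pre_digraph.cycle G p \<and> 3 \<le> length p)"

text \<open>In a \<open>graph\<close>, \<open>out_degree\<close> (which equals \<open>in_degree\<close>) is the number of neighbours.\<close>

definition leaf_order :: "('a, 'b) pre_digraph \<Rightarrow> nat" where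
  "leaf_order G = card {v \<in> verts G. out_degree G v = 1}"

definition closed_nbhd :: "('a, 'b) pre_digraph \<Rightarrow> 'a set \<Rightarrow> 'a set" where
  "closed_nbhd G D = D \<union> {v. \<exists>u\<in>D. u \<rightarrow>\<^bsub>G\<^esub> v}"

definition isolating_set :: "nat \<Rightarrow> ('a, 'b) pre_digraph \<Rightarrow> 'a set \<Rightarrow> bool" where
  "isolating_set k G D \<longleftrightarrow>
     D \<subseteq> verts G \<and> \<not> (\<exists>H. subgraph H (G \<restriction> (verts G - closed_nbhd G D)) \<and> K\<^bsub>1,k\<^esub> H)"

definition isolation_number :: "nat \<Rightarrow> ('a, 'b) pre_digraph \<Rightarrow> nat" where
  "isolation_number k G = (LEAST m. \<exists>D. isolating_set k G D \<and> card D = m)"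

end

theory Submission
  imports Defs
begin

text \<open>
  The bound is proved by rooting the tree at a vertex \<open>r\<close> and building an isolating set from the
  leaves upwards. A tree with a single vertex needs no chosen vertex. With \<open>c v\<close> the number of
  children of \<open>v\<close>, counting vertices and leaves gives \<open>n + \<ell> = 1 + (\<Sum>v. max 1 (c v))\<close> for \<open>n \<ge> 2\<close>,
  plus \<open>1\<close> if the root itself is a leaf (\<open>sum_weight\<close>, \<open>leaf_order_eq\<close>). So it is enough to pay \<open>2k + 1\<close> for every chosen vertex out of the weights
  \<open>max 1 (c v)\<close>, up to a debt of \<open>1\<close>, or of \<open>2\<close> if the root has a single child.

  Vertices are labelled as chosen, dominated or undominated, where a dominated vertex needs a chosen
  neighbour and an undominated one has fewer than \<open>k\<close> undominated neighbours. The chosen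
  vertices of such a labelling form an isolating set, and whether the label of \<open>v\<close> is admissible
  depends only on the labels of its parent and its children, so labellings of the subtrees below
  the children of \<open>v\<close> can be chosen independently and glued (\<open>feasible_node\<close>).

  What a subtree offers to its parent is thus a table: for each demand on the labels of its root
  and of the parent, the largest surplus of weight over payment. Five
  tables suffice as lower bounds (\<open>has_kind\<close>), and the heart of the proof is that a vertex whose
  children have kinds from this list has itself a kind from this list (\<open>exists_kind\<close>). The debt of
  the root's kind never exceeds the one allowed above, which is the theorem.
\<close>

section \<open>Rooted trees given by a parent function\<close>

definition children :: "'a set \<Rightarrow> 'a \<Rightarrow> ('a \<Rightarrow> 'a) \<Rightarrow> 'a \<Rightarrow> 'a set" where
  "children V r par x = {y \<in> V - {r}. par y = x}"

text \<open>
  The root has no parent; \<open>par r\<close> is arbitrary. The depth certifies that following \<open>par\<close> never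
  returns to its starting point; it need not be the distance to the root.
\<close>

locale rooted_tree =
  fixes V :: "'a set" and r :: 'a and par :: "'a \<Rightarrow> 'a" and depth :: "'a \<Rightarrow> nat"
  assumes finite_V: "finite V"
    and root_in: "r \<in> V"
    and par_in: "v \<in> V \<Longrightarrow> v \<noteq> r \<Longrightarrow> par v \<in> V"
    and depth_par: "v \<in> V \<Longrightarrow> v \<noteq> r \<Longrightarrow> depth (par v) < depth v"
begin

abbreviation ch :: "'a \<Rightarrow> 'a set" where
  "ch \<equiv> children V r par"

lemma ch_iff: "y \<in> ch x \<longleftrightarrow> y \<in> V \<and> y \<noteq> r \<and> par y = x"
  by (auto simp: children_def)

lemma finite_ch: "finite (ch x)"
  using finite_V by (simp add: children_def)

definition up :: "('a \<times> 'a) set" where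
  "up = {(y, par y) | y. y \<in> V - {r}}"

definition subtree :: "'a \<Rightarrow> 'a set" where
  "subtree x = {v \<in> V. (v, x) \<in> up\<^sup>*}"

lemma subtree_subset: "subtree x \<subseteq> V"
  by (auto simp: subtree_def)

lemma finite_subtree: "finite (subtree x)"
  using finite_V subtree_subset finite_subset by blast

lemma in_subtree_self: "x \<in> V \<Longrightarrow> x \<in> subtree x"
  by (simp add: subtree_def)

lemma up_depth:
  assumes "(v, x) \<in> up\<^sup>*"
  shows "v = x \<or> depth x < depth v"
  using assms
proof (induction rule: rtrancl_induct)
  case base
  then show ?case by simp
next
  case (step y z)
  then have "depth z < depth y" using depth_par by (auto simp: up_def)
  then show ?case using step.IH by auto
qed

lemma subtree_unfold: "x \<in> V \<Longrightarrow> subtree x = insert x (\<Union>y\<in>ch x. subtree y)"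
proof (intro set_eqI iffI)
  fix v assume "v \<in> subtree x"
  then show "v \<in> insert x (\<Union>y\<in>ch x. subtree y)"
    by (auto simp: subtree_def up_def ch_iff elim: rtranclE)
next
  fix v assume "x \<in> V" "v \<in> insert x (\<Union>y\<in>ch x. subtree y)"
  then show "v \<in> subtree x"
    by (auto simp: subtree_def up_def ch_iff intro: rtrancl_into_rtrancl)
qed

lemma not_in_subtree_child: "y \<in> ch x \<Longrightarrow> x \<notin> subtree y"
  using up_depth[of x y] depth_par[of y] by (auto simp: subtree_def ch_iff)

lemma up_functional: "(a, b) \<in> up \<Longrightarrow> (a, c) \<in> up \<Longrightarrow> b = c"
  by (auto simp: up_def)

lemma up_linear:
  assumes "(v, a) \<in> up\<^sup>*" "(v, b) \<in> up\<^sup>*"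
  shows "(a, b) \<in> up\<^sup>* \<or> (b, a) \<in> up\<^sup>*"
  using assms
proof (induction rule: rtrancl_induct)
  case base
  then show ?case by simp
next
  case (step y z)
  then show ?case
    by (metis converse_rtranclE up_functional r_into_rtrancl rtrancl.rtrancl_into_rtrancl)
qed

lemma subtree_disjoint_aux:
  assumes "a \<in> ch x" "b \<in> ch x" "(a, b) \<in> up\<^sup>*"
  shows "a = b"
proof (rule ccontr)
  assume "a \<noteq> b"
  then obtain c where c: "(a, c) \<in> up" "(c, b) \<in> up\<^sup>*"
    using assms(3) by (metis converse_rtranclE)
  then have "c = x" using assms(1) by (auto simp: up_def ch_iff)
  then have "x \<in> subtree b" using c assms(1) par_in[of a] by (auto simp: subtree_def ch_iff)
  then show False using not_in_subtree_child[OF assms(2)] by simp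
qed

lemma subtree_disjoint:
  assumes "a \<in> ch x" "b \<in> ch x" "v \<in> subtree a" "v \<in> subtree b"
  shows "a = b"
  using up_linear[of v a b] subtree_disjoint_aux[of a x b] subtree_disjoint_aux[of b x a] assms
  by (auto simp: subtree_def)

lemma par_in_subtree: "v \<in> subtree x \<Longrightarrow> v \<noteq> x \<Longrightarrow> v \<noteq> r \<and> par v \<in> subtree x"
  using par_in by (auto simp: subtree_def up_def elim: converse_rtranclE)

lemma ch_subset_subtree: "v \<in> subtree x \<Longrightarrow> ch v \<subseteq> subtree x"
  by (auto simp: subtree_def up_def ch_iff intro: converse_rtrancl_into_rtrancl)

lemma up_root: "v \<in> V \<Longrightarrow> (v, r) \<in> up\<^sup>*"
proof (induction "depth v" arbitrary: v rule: less_induct)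
  case less
  show ?case
  proof (cases "v = r")
    case False
    then have "(par v, r) \<in> up\<^sup>*" "(v, par v) \<in> up"
      using less par_in depth_par by (auto simp: up_def)
    then show ?thesis by (rule converse_rtrancl_into_rtrancl[rotated])
  qed simp
qed

lemma subtree_root: "subtree r = V"
  using up_root by (auto simp: subtree_def)

lemma children_induct [consumes 1, case_names node]:
  assumes "x \<in> V" and step: "\<And>x. x \<in> V \<Longrightarrow> (\<And>y. y \<in> ch x \<Longrightarrow> P y) \<Longrightarrow> P x"
  shows "P x"
  using assms(1)
proof (induction "card (subtree x)" arbitrary: x rule: less_induct)
  case less
  have "P y" if y: "y \<in> ch x" for y
  proof -
    have "subtree y \<subset> subtree x"
      using y subtree_unfold[OF less.prems] not_in_subtree_child[OF y] by auto
    then have "card (subtree y) < card (subtree x)" by (simp add: finite_subtree psubset_card_mono)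
    then show ?thesis using less.hyps y by (auto simp: ch_iff)
  qed
  then show ?case using step less.prems by blast
qed

lemma sum_subtree:
  assumes "x \<in> V"
  shows "sum f (subtree x) = f x + (\<Sum>y\<in>ch x. sum f (subtree y))"
proof -
  have "sum f (subtree x) = f x + sum f (\<Union>y\<in>ch x. subtree y)"
    using subtree_unfold[OF assms] not_in_subtree_child by (simp add: finite_ch finite_subtree)
  also have "sum f (\<Union>y\<in>ch x. subtree y) = (\<Sum>y\<in>ch x. sum f (subtree y))"
    using subtree_disjoint by (intro sum.UNION_disjoint) (auto simp: finite_ch finite_subtree)
  finally show ?thesis .
qed

section \<open>Counting vertices and leaves by children\<close>

text \<open>
  A vertex without children has weight \<open>1\<close>: apart from the root this weight stands for a leaf, while
  the sum of the numbers of children counts all vertices other than the root.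
\<close>

definition weight :: "'a \<Rightarrow> int" where
  "weight v = max 1 (int (card (ch v)))"

lemma sum_card_ch: "(\<Sum>v\<in>V. card (ch v)) = card V - 1"
proof -
  have "(\<Sum>v\<in>V. card (ch v)) = card (\<Union>v\<in>V. ch v)"
    using finite_V finite_ch by (intro card_UN_disjoint[symmetric]) (auto simp: ch_iff)
  also have "(\<Union>v\<in>V. ch v) = V - {r}"
    using par_in by (auto simp: children_def)
  finally show ?thesis using root_in finite_V by simp
qed

lemma sum_weight: "(\<Sum>v\<in>V. weight v) = int (card V) - 1 + int (card {v \<in> V. ch v = {}})"
proof -
  have "(\<Sum>v\<in>V. weight v) = (\<Sum>v\<in>V. int (card (ch v)) + (if ch v = {} then 1 else 0))"
    using finite_ch by (intro sum.cong) (auto simp: weight_def max_def Suc_le_eq card_gt_0_iff)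
  also have "\<dots> = int (card V - 1) + int (card {v \<in> V. ch v = {}})"
    using finite_V by (simp add: sum.distrib sum_card_ch[symmetric] sum.If_cases Int_def del: One_nat_def)
  finally show ?thesis
    using root_in finite_V card_gt_0_iff[of V] by (auto simp: of_nat_diff Suc_le_eq)
qed

end

section \<open>Labellings that encode isolating sets\<close>

datatype label = Chosen | Dominated | Undominated

context rooted_tree
begin

text \<open>
  The label \<open>q\<close> of the parent is a separate argument, so that a subtree can be labelled before its
  surroundings are known. At the root of the whole tree \<open>q = Dominated\<close> stands for the missing
  parent, as it neither dominates \<open>v\<close> nor counts as an undominated neighbour.
\<close>

definition valid :: "nat \<Rightarrow> label \<Rightarrow> ('a \<Rightarrow> label) \<Rightarrow> 'a \<Rightarrow> bool" where
  "valid k q L v \<longleftrightarrow> (case L v of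
     Chosen \<Rightarrow> True
   | Dominated \<Rightarrow> q = Chosen \<or> (\<exists>y\<in>ch v. L y = Chosen)
   | Undominated \<Rightarrow> card {y \<in> ch v. L y = Undominated} + (if q = Undominated then 1 else 0) < k)"

definition valid_on :: "nat \<Rightarrow> label \<Rightarrow> ('a \<Rightarrow> label) \<Rightarrow> 'a \<Rightarrow> bool" where
  "valid_on k q L x \<longleftrightarrow> (\<forall>v\<in>subtree x. valid k (if v = x then q else L (par v)) L v)"

definition cost :: "nat \<Rightarrow> label \<Rightarrow> int" where
  "cost k l = (if l = Chosen then 2 * int k + 1 else 0)"

text \<open>
  The surplus \<open>f\<close> may be negative: then the subtree at \<open>x\<close> can be labelled, in the surroundings
  described by \<open>q\<close> and \<open>S\<close>, at the price of a debt \<open>- f\<close> beyond its own weight.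
\<close>

definition feasible :: "nat \<Rightarrow> label \<Rightarrow> label set \<Rightarrow> 'a \<Rightarrow> int \<Rightarrow> bool" where
  "feasible k q S x f \<longleftrightarrow>
     (\<exists>L. valid_on k q L x \<and> L x \<in> S \<and> (\<Sum>v\<in>subtree x. cost k (L v)) + f \<le> (\<Sum>v\<in>subtree x. weight v))"

text \<open>
  A labelling that copes with an undominated parent also copes with a dominated one, and
  any parent may be replaced by a chosen one. If \<open>x\<close> is chosen, its parent's label is irrelevant.
\<close>

lemma feasible_mono:
  assumes "feasible k q S x f" "S \<subseteq> S'" "f' \<le> f"
    and "q = q' \<or> q = Undominated \<or> q' = Chosen \<or> S = {Chosen}"
  shows "feasible k q' S' x f'"
proof -
  obtain L where L: "valid_on k q L x" "L x \<in> S"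
      "(\<Sum>v\<in>subtree x. cost k (L v)) + f \<le> (\<Sum>v\<in>subtree x. weight v)"
    using assms(1) by (auto simp: feasible_def)
  have "valid k q' L x" if "valid k q L x"
    using that assms(4) L(2) by (auto simp: valid_def split: label.splits if_splits)
  then have "valid_on k q' L x" using L(1) by (auto simp: valid_on_def)
  then show ?thesis using L assms(2,3) unfolding feasible_def by (intro exI[of _ L]) auto
qed

text \<open>
  Once the label \<open>l\<close> of \<open>x\<close> is fixed, the subtrees below its children no longer interact. The
  hypothesis on \<open>valid\<close> is therefore all that has to be checked to glue labellings of these
  subtrees, and the surpluses add up.
\<close>

lemma feasible_node:
  assumes x: "x \<in> V"
    and feas: "\<And>y. y \<in> ch x \<Longrightarrow> feasible k l (S y) y (g y)"
    and val: "\<And>L. L x = l \<Longrightarrow> (\<And>y. y \<in> ch x \<Longrightarrow> L y \<in> S y) \<Longrightarrow> valid k q L x"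
    and f: "f \<le> weight x + sum g (ch x) - cost k l"
  shows "feasible k q {l} x f"
proof -
  have "\<forall>y\<in>ch x. \<exists>L. valid_on k l L y \<and> L y \<in> S y \<and>
          (\<Sum>v\<in>subtree y. cost k (L v)) + g y \<le> (\<Sum>v\<in>subtree y. weight v)"
    using feas by (auto simp: feasible_def)
  then obtain M where M: "\<And>y. y \<in> ch x \<Longrightarrow> valid_on k l (M y) y"
      "\<And>y. y \<in> ch x \<Longrightarrow> M y y \<in> S y"
      "\<And>y. y \<in> ch x \<Longrightarrow> (\<Sum>v\<in>subtree y. cost k (M y v)) + g y \<le> (\<Sum>v\<in>subtree y. weight v)"
    by metis
  define L where "L v = (if v = x then l else M (THE y. y \<in> ch x \<and> v \<in> subtree y) v)" for v
  have Lx: "L x = l" by (simp add: L_def)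
  have LM: "L v = M y v" if "y \<in> ch x" "v \<in> subtree y" for y v
  proof -
    have "(THE y. y \<in> ch x \<and> v \<in> subtree y) = y"
      using that subtree_disjoint by blast
    moreover have "v \<noteq> x" using that not_in_subtree_child by blast
    ultimately show ?thesis by (simp add: L_def)
  qed
  have self: "y \<in> subtree y" if "y \<in> ch x" for y
    using that in_subtree_self by (simp add: ch_iff)
  have LS: "L y \<in> S y" if "y \<in> ch x" for y
    using M(2) LM self that by simp
  have "valid k (if v = x then q else L (par v)) L v" if v: "v \<in> subtree x" for v
  proof (cases "v = x")
    case True
    then show ?thesis using val[OF Lx LS] by simp
  next
    case False
    then obtain y where y: "y \<in> ch x" "v \<in> subtree y" using v subtree_unfold[OF x] by auto
    have "{u \<in> ch v. M y u = Undominated} = {u \<in> ch v. L u = Undominated}"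
      and "(\<exists>u\<in>ch v. M y u = Chosen) \<longleftrightarrow> (\<exists>u\<in>ch v. L u = Chosen)"
      using ch_subset_subtree[OF y(2)] LM[OF y(1)] by (auto simp: subset_iff)
    then have eq: "valid k p (M y) v = valid k p L v" for p
      using LM[OF y] by (simp add: valid_def split: label.split)
    have "valid k (if v = y then l else M y (par v)) (M y) v"
      using M(1)[OF y(1)] y(2) by (simp add: valid_on_def)
    moreover have "(if v = y then l else M y (par v)) = L (par v)"
    proof (cases "v = y")
      case True
      then show ?thesis using y Lx by (simp add: ch_iff)
    next
      case False
      then show ?thesis using par_in_subtree[OF y(2)] LM[OF y(1)] by simp
    qed
    ultimately show ?thesis using eq False by simp
  qed
  then have "valid_on k q L x" by (simp add: valid_on_def)
  moreover have "(\<Sum>v\<in>subtree x. cost k (L v)) + f \<le> (\<Sum>v\<in>subtree x. weight v)"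
  proof -
    have "(\<Sum>v\<in>subtree x. cost k (L v)) = cost k l + (\<Sum>y\<in>ch x. \<Sum>v\<in>subtree y. cost k (M y v))"
      using sum_subtree[OF x, of "\<lambda>v. cost k (L v)"] LM Lx by simp
    moreover have "(\<Sum>y\<in>ch x. (\<Sum>v\<in>subtree y. cost k (M y v)) + g y) \<le> (\<Sum>y\<in>ch x. \<Sum>v\<in>subtree y. weight v)"
      by (intro sum_mono M(3))
    ultimately show ?thesis
      using f sum_subtree[OF x, of weight] by (simp add: sum.distrib)
  qed
  ultimately show ?thesis using Lx by (auto simp: feasible_def)
qed

section \<open>The five kinds of subtrees\<close>

text \<open>
  The kinds are the worst cases of the optimisation from the leaves to the root. Typical examples
  for \<open>k \<ge> 2\<close>: a leaf is \<open>Slack\<close>, since it costs nothing and keeps its weight; a vertex with \<open>k - 1\<close> leaf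
  children is \<open>Critical\<close>, since it needs no chosen vertex unless its parent stays undominated; the
  parent of such a vertex, with no other child, is \<open>Above_critical\<close>; a vertex with \<open>k\<close> leaf
  children is \<open>Paid\<close>, choosing it and owing \<open>1\<close>; and the parent of a \<open>Paid\<close> vertex, with no
  other child, is \<open>Covered\<close>, as it is dominated from below and its weight settles the debt.

  The conditions on children in the last two kinds matter at the root: they decide which debt is
  allowed there.
\<close>

datatype (in -) kind = Covered | Slack | Critical | Above_critical | Paid

definition has_kind :: "nat \<Rightarrow> kind \<Rightarrow> 'a \<Rightarrow> bool" where
  "has_kind k t x \<longleftrightarrow> (case t of
     Covered \<Rightarrow> feasible k Undominated {Chosen, Dominated} x 0
   | Slack \<Rightarrow> feasible k Undominated UNIV x 1
   | Critical \<Rightarrow> feasible k Dominated UNIV x (2 * int k - 2)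
   | Above_critical \<Rightarrow> feasible k Undominated {Chosen} x (- 2) \<and>
       feasible k Chosen UNIV x (2 * int k - 1) \<and> card (ch x) = 1
   | Paid \<Rightarrow> feasible k Undominated {Chosen} x (- 1) \<and> ch x \<noteq> {})"

text \<open>The surplus that a subtree offers when the parent of its root is chosen.\<close>

definition chosen_gain :: "nat \<Rightarrow> kind \<Rightarrow> int" where
  "chosen_gain k t = (case t of Covered \<Rightarrow> 0 | Slack \<Rightarrow> 1 | Critical \<Rightarrow> 2 * int k - 2
     | Above_critical \<Rightarrow> 2 * int k - 1 | Paid \<Rightarrow> - 1)"

lemma feasible_chosen_gain:
  assumes "has_kind k t x"
  shows "feasible k Chosen UNIV x (chosen_gain k t)"
  using assms by (cases t) (auto simp: has_kind_def chosen_gain_def intro: feasible_mono feasible_mono[where S = "{Chosen}"])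

text \<open>
  Let every child contribute \<open>1\<close>, its share in the weight of \<open>x\<close>, plus its \<open>chosen_gain\<close>. The
  contributions are \<open>0\<close> for \<open>Paid\<close>, \<open>1\<close> for \<open>Covered\<close>, \<open>2\<close> for \<open>Slack\<close>, \<open>2k - 1\<close> for \<open>Critical\<close>
  and \<open>2k\<close> for \<open>Above_critical\<close> children. If they reach \<open>2k\<close>, then \<open>x\<close> can be chosen with debt at
  most \<open>1\<close>, and \<open>x\<close> is \<open>Paid\<close>. Otherwise there is no \<open>Above_critical\<close> child. If there is a \<open>Paid\<close>
  child, it is chosen and dominates \<open>x\<close>. If not, a \<open>Critical\<close> child leaves no room for
  another child, so \<open>x\<close> is \<open>Above_critical\<close>. In the remaining case all children are \<open>Covered\<close> or
  \<open>Slack\<close> and \<open>x\<close> can stay undominated: only \<open>Slack\<close> children may be undominated as well, and there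
  are fewer than \<open>k\<close> of these; if there are \<open>k - 1\<close>, the parent of \<open>x\<close> must not be undominated.
\<close>

lemma exists_kind:
  assumes k: "k \<ge> 1" and "x \<in> V"
  shows "\<exists>t. has_kind k t x"
  using assms(2)
proof (induction rule: children_induct)
  case (node x)
  then obtain t where t: "\<And>y. y \<in> ch x \<Longrightarrow> has_kind k (t y) y" by metis
  note [simp] = finite_ch
  have weight_ge: "int (card (ch x)) \<le> weight x" "1 \<le> weight x" by (auto simp: weight_def)
  have gain: "int (card (ch x)) + (\<Sum>y\<in>ch x. chosen_gain k (t y)) =
      (\<Sum>y\<in>ch x. 1 + chosen_gain k (t y))" by (simp add: sum.distrib)
  have nonneg: "0 \<le> 1 + chosen_gain k s" for s
    using k by (cases s) (auto simp: chosen_gain_def)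
  have subset: "(\<Sum>y\<in>A. 1 + chosen_gain k (t y)) \<le> (\<Sum>y\<in>ch x. 1 + chosen_gain k (t y))"
    if "A \<subseteq> ch x" for A
    using that nonneg by (intro sum_mono2) auto
  have chosen: "feasible k q {Chosen} x f"
    if "f \<le> weight x + (\<Sum>y\<in>ch x. chosen_gain k (t y)) - (2 * int k + 1)" for f q
  proof (rule feasible_node[OF \<open>x \<in> V\<close>, where S = "\<lambda>_. UNIV" and g = "\<lambda>y. chosen_gain k (t y)"])
    show "f \<le> weight x + (\<Sum>y\<in>ch x. chosen_gain k (t y)) - cost k Chosen"
      using that by (simp add: cost_def)
  qed (use t feasible_chosen_gain in \<open>auto simp: valid_def\<close>)
  (* 2 k + 1 is the payment for x itself, so contributions of 2 k leave a debt of 1 *)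
  show ?case
  proof (cases "(\<Sum>y\<in>ch x. 1 + chosen_gain k (t y)) \<ge> 2 * int k")
    case True
    then have "ch x \<noteq> {}" using k by auto
    moreover have "feasible k Undominated {Chosen} x (- 1)"
      using True gain weight_ge by (intro chosen) linarith
    ultimately have "has_kind k Paid x" by (simp add: has_kind_def)
    then show ?thesis ..
  next
    case small: False
    have gain_A: "(\<Sum>y\<in>A. 1 + chosen_gain k (t y)) < 2 * int k" if "A \<subseteq> ch x" for A
      using subset[OF that] small by linarith
    have no_above: "t y \<noteq> Above_critical" if "y \<in> ch x" for y
      using gain_A[of "{y}"] that by (auto simp: chosen_gain_def)
    show ?thesis
    proof (cases "\<exists>y\<in>ch x. t y = Paid")
      case True
      then obtain z where z: "z \<in> ch x" "t z = Paid" by blast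
      have "feasible k Undominated {Dominated} x 0"
      proof (rule feasible_node[OF \<open>x \<in> V\<close>, where
            S = "\<lambda>y. if t y = Paid then {Chosen} else UNIV" and g = "\<lambda>y. chosen_gain k (t y)"])
        fix y assume y: "y \<in> ch x"
        show "feasible k Dominated (if t y = Paid then {Chosen} else UNIV) y (chosen_gain k (t y))"
          using t[OF y] no_above[OF y]
          by (cases "t y") (auto simp: has_kind_def chosen_gain_def intro: feasible_mono feasible_mono[where S = "{Chosen}"])
      next
        fix L assume "L x = Dominated" "\<And>y. y \<in> ch x \<Longrightarrow> L y \<in> (if t y = Paid then {Chosen} else UNIV)"
        from this(1) this(2)[OF z(1)] show "valid k Undominated L x"
          using z by (auto simp: valid_def)
      next
        show "0 \<le> weight x + (\<Sum>y\<in>ch x. chosen_gain k (t y)) - cost k Dominated"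
          using gain subset[of "{}"] weight_ge by (simp add: cost_def)
      qed
      then have "has_kind k Covered x" by (auto simp: has_kind_def elim: feasible_mono)
      then show ?thesis ..
    next
      case no_paid: False
      show ?thesis
      proof (cases "\<exists>y\<in>ch x. t y = Critical")
        case True
        then obtain z where z: "z \<in> ch x" "t z = Critical" by blast
        (* any second child would bring the contributions to at least (2 k - 1) + 1 *)
        have "ch x = {z}"
        proof (rule ccontr)
          assume "ch x \<noteq> {z}"
          then obtain y where y: "y \<in> ch x" "y \<noteq> z" using z by blast
          then have "1 + chosen_gain k (t y) \<ge> 1"
            using no_paid no_above[of y] k by (cases "t y") (auto simp: chosen_gain_def)
          then show False using gain_A[of "{y, z}"] y z by (simp add: chosen_gain_def)
        qed
        moreover from this have "feasible k Chosen {Dominated} x (2 * int k - 1)"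
          using t[OF z(1)] z weight_ge
          by (intro feasible_node[OF \<open>x \<in> V\<close>, where S = "\<lambda>_. UNIV" and g = "\<lambda>_. 2 * int k - 2"])
            (auto simp: has_kind_def valid_def cost_def)
        moreover have "feasible k Undominated {Chosen} x (- 2)"
          using \<open>ch x = {z}\<close> z weight_ge by (intro chosen) (simp add: chosen_gain_def)
        ultimately have "has_kind k Above_critical x"
          by (auto simp: has_kind_def elim: feasible_mono)
        then show ?thesis ..
      next
        case False
        have kinds: "t y = Covered \<or> t y = Slack" if "y \<in> ch x" for y
          using that False no_paid no_above[OF that] by (cases "t y") auto
        define slack where "slack = {y \<in> ch x. t y = Slack}"
        define m where "m = card slack"
        have gain_m: "(\<Sum>y\<in>slack. 1 + chosen_gain k (t y)) = 2 * int m"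
          by (simp add: slack_def m_def chosen_gain_def)
        then have "m < k" using gain_A[of "slack"] by (auto simp: slack_def)
        have und: "feasible k q {Undominated} x f"
          if q: "m + (if q = Undominated then 1 else 0) < k"
            and f: "f \<le> weight x + (\<Sum>y\<in>ch x. chosen_gain k (t y))" for q f
        proof (rule feasible_node[OF \<open>x \<in> V\<close>, where g = "\<lambda>y. chosen_gain k (t y)" and
              S = "\<lambda>y. if t y = Slack then UNIV else {Chosen, Dominated}"])
          fix y assume y: "y \<in> ch x"
          show "feasible k Undominated (if t y = Slack then UNIV else {Chosen, Dominated}) y (chosen_gain k (t y))"
            using t[OF y] kinds[OF y] by (auto simp: has_kind_def chosen_gain_def)
        next
          fix L assume L: "L x = Undominated"
            "\<And>y. y \<in> ch x \<Longrightarrow> L y \<in> (if t y = Slack then UNIV else {Chosen, Dominated})"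
          have "{y \<in> ch x. L y = Undominated} \<subseteq> slack"
            using L(2) by (force simp: slack_def split: if_splits)
          then have "card {y \<in> ch x. L y = Undominated} \<le> m"
            unfolding m_def by (intro card_mono) (simp_all add: slack_def)
          then show "valid k q L x" using q L(1) by (auto simp: valid_def)
        next
          show "f \<le> weight x + (\<Sum>y\<in>ch x. chosen_gain k (t y)) - cost k Undominated"
            using f by (simp add: cost_def)
        qed
        show ?thesis
        proof (cases "m + 1 < k")
          case True
          (* a leaf has no contributions, so the surplus 1 comes from max 1 in the weight *)
          have "0 \<le> (\<Sum>y\<in>ch x. chosen_gain k (t y))"
            using kinds by (intro sum_nonneg) (force simp: chosen_gain_def)
          then have "feasible k Undominated {Undominated} x 1"
            using True weight_ge by (intro und) auto
          then have "has_kind k Slack x" by (auto simp: has_kind_def elim: feasible_mono)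
          then show ?thesis ..
        next
          case False
          then have "m + 1 = k" using \<open>m < k\<close> by simp
          then have "2 * int k - 2 \<le> weight x + (\<Sum>y\<in>ch x. chosen_gain k (t y))"
            using subset[of "slack"] gain gain_m weight_ge by (auto simp: slack_def)
          then have "feasible k Dominated {Undominated} x (2 * int k - 2)"
            using \<open>m < k\<close> by (intro und) auto
          then have "has_kind k Critical x" by (auto simp: has_kind_def elim: feasible_mono)
          then show ?thesis ..
        qed
      qed
    qed
  qed
qed

end


section \<open>Rooting an undirected tree\<close>

definition rooted_on :: "('a, 'b) pre_digraph \<Rightarrow> 'a set \<Rightarrow> 'a \<Rightarrow> ('a \<Rightarrow> 'a) \<Rightarrow> ('a \<Rightarrow> nat) \<Rightarrow> bool" where
  "rooted_on G S r par depth \<longleftrightarrow> rooted_tree S r par depth \<and>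
     (\<forall>u\<in>S. \<forall>v\<in>S. u \<rightarrow>\<^bsub>G\<^esub> v \<longleftrightarrow> v \<in> children S r par u \<or> u \<in> children S r par v)"

context graph
begin

lemma dominates_sym: "u \<rightarrow>\<^bsub>G\<^esub> v \<Longrightarrow> v \<rightarrow>\<^bsub>G\<^esub> u"
  by (rule arcs_ends_symmetric[OF sym_arcs])

lemma rooted_on_reaches_root:
  assumes "rooted_on G S r par depth" "u \<in> S"
  shows "u \<rightarrow>\<^sup>*\<^bsub>G \<restriction> S\<^esub> r"
proof -
  interpret R: rooted_tree S r par depth using assms by (simp add: rooted_on_def)
  interpret H: wf_digraph "G \<restriction> S" by (rule wellformed_induce_subgraph)
  show ?thesis using assms(2)
  proof (induction "depth u" arbitrary: u rule: less_induct)
    case less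
    show ?case
    proof (cases "u = r")
      case True
      then show ?thesis using H.reachable_refl[of u] less.prems by simp
    next
      case False
      then have p: "par u \<in> S" "depth (par u) < depth u" "u \<in> R.ch (par u)"
        using less.prems R.par_in R.depth_par by (auto simp: R.ch_iff)
      then have "u \<rightarrow>\<^bsub>G\<^esub> par u" using assms(1) less.prems by (simp add: rooted_on_def)
      then obtain e where "e \<in> arcs G" "tail G e = u" "head G e = par u" by (rule reachableE)
      then have "u \<rightarrow>\<^bsub>G \<restriction> S\<^esub> par u"
        using p(1) less.prems by (intro H.dominatesI[of e]) (simp_all add: arc_to_ends_def)
      then show ?thesis using less.hyps[OF p(2,1)] by (rule H.adj_reachable_trans)
    qed
  qed
qed

text \<open>
  Two different neighbours of \<open>v\<close> inside \<open>S\<close> would be joined by a path inside \<open>S\<close>, which \<open>v\<close>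
  closes to a cycle. Its length is at least \<open>3\<close> because the path has at least one arc.
\<close>

lemma rooted_on_attachment_unique:
  assumes acyclic: "\<not> (\<exists>p. cycle p \<and> 3 \<le> length p)"
    and R: "rooted_on G S r par depth" and S: "S \<subseteq> verts G" and v: "v \<notin> S"
    and a: "a \<in> S" "v \<rightarrow>\<^bsub>G\<^esub> a" and b: "b \<in> S" "v \<rightarrow>\<^bsub>G\<^esub> b"
  shows "a = b"
proof (rule ccontr)
  assume "a \<noteq> b"
  interpret H: wf_digraph "G \<restriction> S" by (rule wellformed_induce_subgraph)
  have induced: "subgraph (G \<restriction> S) G" using induced_induce[OF S] by (rule induced_imp_subgraph)
  have "symmetric (G \<restriction> S)"
    using induced_graph_imp_symmetric[OF sym_arcs induced_induce[OF S]] .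
  then have "a \<rightarrow>\<^sup>*\<^bsub>G \<restriction> S\<^esub> b"
    using H.reachable_trans[OF rooted_on_reaches_root[OF R a(1)]]
      symmetric_reachable[OF _ rooted_on_reaches_root[OF R b(1)]] by simp
  then obtain p where p: "H.apath a p b" using H.reachable_apath by blast
  then have walk: "awalk a p b" "distinct (awalk_verts a p)"
    using subgraph_apath_imp_apath[OF p induced] by (auto simp: apath_def)
  have "H.awalk a p b" using p by (rule H.awalkI_apath)
  then have "set (H.awalk_verts a p) \<subseteq> verts (G \<restriction> S)" by (rule H.awalkE')
  then have "set (H.awalk_verts a p) \<subseteq> S" by (simp only: induce_subgraph_verts)
  moreover have "H.awalk_verts a p = awalk_verts a p"
    by (simp add: H.awalk_verts_conv awalk_verts_conv)
  ultimately have "v \<notin> set (awalk_verts a p)" using v by auto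
  obtain e where e: "e \<in> arcs G" "tail G e = v" "head G e = a" using a(2) by auto
  obtain f where f: "f \<in> arcs G" "tail G f = b" "head G f = v"
    using dominates_sym[OF b(2)] by auto
  have "awalk v (e # p @ [f]) v"
    using walk(1) e f by (auto simp: awalk_Cons_iff awalk_Nil_iff)
  moreover have "tl (awalk_verts v (e # p @ [f])) = awalk_verts a p @ [v]"
  proof -
    have "awalk a (p @ [f]) v" using walk(1) f by (auto simp: awalk_Cons_iff awalk_Nil_iff)
    from awalk_verts_append[OF this] show ?thesis using e f by simp
  qed
  moreover have "3 \<le> length (e # p @ [f])"
    using \<open>a \<noteq> b\<close> walk(1) by (cases p) (auto simp: awalk_Nil_iff)
  ultimately have "cycle (e # p @ [f]) \<and> 3 \<le> length (e # p @ [f])"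
    using walk(2) \<open>v \<notin> set (awalk_verts a p)\<close> unfolding cycle_def
    by (intro conjI exI[of _ v]) auto
  with acyclic show False by (elim notE) (rule exI)
qed

lemma crossing_edge:
  assumes conn: "connected G" and "S \<subset> verts G" "r \<in> S"
  obtains s v where "s \<in> S" "v \<in> verts G - S" "s \<rightarrow>\<^bsub>G\<^esub> v"
proof -
  obtain w where w: "w \<in> verts G" "w \<notin> S" using assms(2) by blast
  have "r \<rightarrow>\<^sup>*\<^bsub>mk_symmetric G\<^esub> w"
    using conn w(1) assms(2,3) by (auto simp: connected_def strongly_connected_def)
  then have "(r, w) \<in> (arcs_ends G)\<^sup>*"
    using reachable_rtranclI[of "with_proj (mk_symmetric G)" r w]
      adj_mk_symmetric_eq[OF sym_arcs] by simp
  then have "w \<in> S \<or> (\<exists>s v. s \<in> S \<and> v \<in> verts G - S \<and> s \<rightarrow>\<^bsub>G\<^esub> v)"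
    using assms(3) by (induction rule: rtrancl_induct) (auto dest: adj_in_verts)
  then show thesis using w(2) that by blast
qed

text \<open>
  A rooted set grows by attaching any vertex outside it that has a neighbour \<open>s\<close> in it, with \<open>s\<close>
  as its parent: there is no second edge into the set that the parent function would miss.
\<close>

lemma exists_rooted_subset:
  assumes conn: "connected G" and acyclic: "\<not> (\<exists>p. cycle p \<and> 3 \<le> length p)"
    and "1 \<le> m" "m \<le> card (verts G)"
  shows "\<exists>S r par depth. S \<subseteq> verts G \<and> card S = m \<and> rooted_on G S r par depth"
  using assms(3,4)
proof (induction m rule: dec_induct)
  case base
  then obtain r where r: "r \<in> verts G" by (metis card.empty equals0I not_one_le_zero)
  have "rooted_on G {r} r id (\<lambda>_. 0)"
    using adj_not_same by (auto simp: rooted_on_def rooted_tree_def children_def)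
  then show ?case using r by (intro exI[of _ "{r}"]) auto
next
  case (step m)
  then obtain S r par depth where S: "S \<subseteq> verts G" "card S = m" "rooted_on G S r par depth"
    by auto
  interpret R: rooted_tree S r par depth using S(3) by (simp add: rooted_on_def)
  have "S \<subset> verts G" using S step.prems by auto
  then obtain s v where sv: "s \<in> S" "v \<in> verts G - S" "s \<rightarrow>\<^bsub>G\<^esub> v"
    using crossing_edge[OF conn _ R.root_in] by blast
  let ?par = "par(v := s)" and ?depth = "depth(v := Suc (depth s))"
  have "rooted_tree (insert v S) r ?par ?depth"
    using R.finite_V R.root_in R.par_in R.depth_par sv by unfold_locales auto
  moreover have "u \<rightarrow>\<^bsub>G\<^esub> w \<longleftrightarrow>
      w \<in> children (insert v S) r ?par u \<or> u \<in> children (insert v S) r ?par w"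
    if uw: "u \<in> insert v S" "w \<in> insert v S" for u w
  proof -
    have nbr: "v \<rightarrow>\<^bsub>G\<^esub> x \<longleftrightarrow> x = s" "x \<rightarrow>\<^bsub>G\<^esub> v \<longleftrightarrow> x = s" if "x \<in> S" for x
      using rooted_on_attachment_unique[OF acyclic S(3,1)] sv that dominates_sym by blast+
    have ch: "y \<in> children (insert v S) r ?par x \<longleftrightarrow> (if y = v then x = s else y \<in> R.ch x)" for x y
      using sv R.root_in by (auto simp: children_def)
    have no_ch: "y \<notin> R.ch v" for y using sv R.par_in by (auto simp: R.ch_iff)
    have old: "x \<rightarrow>\<^bsub>G\<^esub> y \<longleftrightarrow> y \<in> R.ch x \<or> x \<in> R.ch y" if "x \<in> S" "y \<in> S" for x y
      using S(3) that by (auto simp: rooted_on_def)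
    have "v \<noteq> s" using sv by blast
    consider "u = v" "w = v" | "u = v" "w \<in> S" "w \<noteq> v" | "u \<in> S" "w = v" "u \<noteq> v"
      | "u \<in> S" "w \<in> S" "u \<noteq> v" "w \<noteq> v"
      using uw sv by blast
    then show ?thesis
    proof cases
      case 1
      then show ?thesis using adj_not_same[of v] \<open>v \<noteq> s\<close> by (simp add: ch) blast
    next
      case 2
      then show ?thesis by (simp add: ch nbr no_ch)
    next
      case 3
      then show ?thesis by (simp add: ch nbr no_ch)
    next
      case 4
      then show ?thesis by (simp add: ch old)
    qed
  qed
  ultimately have "rooted_on G (insert v S) r ?par ?depth" by (auto simp: rooted_on_def)
  moreover have "card (insert v S) = Suc m" using sv S R.finite_V by auto
  ultimately show ?case using S(1) sv(2) by (intro exI[of _ "insert v S"]) auto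
qed

lemma out_degree_eq_card: "out_degree G u = card {v. u \<rightarrow>\<^bsub>G\<^esub> v}"
proof -
  have "inj_on (head G) (out_arcs G u)"
    by (rule inj_onI) (auto intro!: no_multi_arcs simp: arc_to_ends_def)
  moreover have "head G ` out_arcs G u = {v. u \<rightarrow>\<^bsub>G\<^esub> v}"
    by (auto simp: arcs_ends_conv image_iff)
  ultimately show ?thesis by (metis card_image out_degree_def)
qed

end

section \<open>From labellings to the isolation number\<close>

lemma isolation_number_le:
  assumes "isolating_set k G D" "card D \<le> m"
  shows "isolation_number k G \<le> m"
proof -
  have "isolation_number k G \<le> card D"
    unfolding isolation_number_def using assms(1) by (intro Least_le) blast
  then show ?thesis using assms(2) by simp
qed

locale rooted_graph = graph G + rooted_tree "verts G" r par depth
  for G :: "('a, 'b) pre_digraph" and r par depth +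
  assumes dominates_iff: "u \<rightarrow>\<^bsub>G\<^esub> v \<longleftrightarrow> v \<in> ch u \<or> u \<in> ch v"
begin

lemma out_degree_eq:
  assumes "u \<in> verts G"
  shows "out_degree G u = card (ch u) + (if u = r then 0 else 1)"
proof -
  have "{v. u \<rightarrow>\<^bsub>G\<^esub> v} = ch u \<union> (if u = r then {} else {par u})"
    using assms by (auto simp: dominates_iff children_def)
  moreover have "par u \<notin> ch u" if "u \<noteq> r"
    using depth_par[of u] depth_par[of "par u"] that assms by (auto simp: ch_iff)
  ultimately show ?thesis by (simp add: out_degree_eq_card finite_ch)
qed

lemma leaf_order_eq:
  assumes "ch r \<noteq> {}"
  shows "leaf_order G = card {v \<in> verts G. ch v = {}} + (if card (ch r) = 1 then 1 else 0)"
proof -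
  have "{v \<in> verts G. out_degree G v = 1} =
      {v \<in> verts G. ch v = {}} \<union> (if card (ch r) = 1 then {r} else {})"
    using assms root_in finite_ch by (auto simp: out_degree_eq card_eq_0_iff split: if_splits)
  then show ?thesis using assms by (simp add: leaf_order_def)
qed

text \<open>
  All vertices outside the closed neighbourhood of the chosen ones are labelled undominated. The
  \<open>k\<close> leaves of a star \<open>K\<^bsub>1,k\<^esub>\<close> among them would be \<open>k\<close> undominated neighbours of its centre.
\<close>

lemma valid_imp_isolating:
  assumes valid: "valid_on k Dominated L r" and k: "k \<ge> 1"
  shows "isolating_set k G {v \<in> verts G. L v = Chosen}"
proof -
  let ?D = "{v \<in> verts G. L v = Chosen}"
  have valid_at: "valid k (if v = r then Dominated else L (par v)) L v" if "v \<in> verts G" for v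
    using valid that by (simp add: valid_on_def subtree_root)
  have undominated: "L v = Undominated" if v: "v \<in> verts G" "v \<notin> closed_nbhd G ?D" for v
  proof -
    have "L u \<noteq> Chosen" if "u = v \<or> u \<rightarrow>\<^bsub>G\<^esub> v" "u \<in> verts G" for u
      using v that by (auto simp: closed_nbhd_def)
    then have "L v \<noteq> Chosen" "\<And>u. u \<in> ch v \<Longrightarrow> L u \<noteq> Chosen" "v \<noteq> r \<Longrightarrow> L (par v) \<noteq> Chosen"
      using v(1) par_in by (auto simp: dominates_iff ch_iff)
    then show ?thesis
      using valid_at[OF v(1)] by (cases "L v") (auto simp: valid_def split: if_splits)
  qed
  have False if H: "subgraph H (G \<restriction> (verts G - closed_nbhd G ?D))" and K: "K\<^bsub>1,k\<^esub> H" for H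
  proof -
    obtain U W where UW: "verts H = U \<union> W" "card U = 1" "card W = k" "arcs_ends H = U \<times> W \<union> W \<times> U"
      using K by (auto simp: complete_bipartite_digraph_def)
    then obtain u where u: "U = {u}" using card_1_singletonE by blast
    have in_rest: "v \<in> verts G \<and> v \<notin> closed_nbhd G ?D" if "v \<in> U \<union> W" for v
      using H that UW(1) by (auto simp: subgraph_def)
    have und: "L v = Undominated" if "v \<in> U \<union> W" for v
      using in_rest[OF that] undominated by blast
    have "u \<rightarrow>\<^bsub>G\<^esub> w" if "w \<in> W" for w
    proof -
      have "u \<rightarrow>\<^bsub>H\<^esub> w" using that UW(4) u by auto
      then have "u \<rightarrow>\<^bsub>G \<restriction> (verts G - closed_nbhd G ?D)\<^esub> w" using arcs_ends_mono[OF H] by blast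
      then show ?thesis by (auto simp: arcs_ends_conv)
    qed
    then have "W \<subseteq> {y \<in> ch u. L y = Undominated} \<union>
        (if u \<noteq> r \<and> L (par u) = Undominated then {par u} else {})"
      using und by (auto simp: dominates_iff ch_iff)
    then have "card W \<le> card ({y \<in> ch u. L y = Undominated} \<union>
        (if u \<noteq> r \<and> L (par u) = Undominated then {par u} else {}))"
      by (intro card_mono) (auto simp: finite_ch)
    also have "\<dots> \<le> card {y \<in> ch u. L y = Undominated} +
        (if u \<noteq> r \<and> L (par u) = Undominated then 1 else 0)"
      by (rule order_trans[OF card_Un_le]) auto
    also have "\<dots> < k"
      using valid_at[of u] und[of u] in_rest[of u] u by (auto simp: valid_def split: if_splits)
    finally show False using UW(3) by simp
  qed
  then show ?thesis by (auto simp: isolating_set_def)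
qed

lemma feasible_imp_isolation_bound:
  assumes feas: "feasible k Dominated S r f" and k: "k \<ge> 1"
  shows "(2 * int k + 1) * int (isolation_number k G) + f \<le> (\<Sum>v\<in>verts G. weight v)"
proof -
  obtain L where L: "valid_on k Dominated L r"
      "(\<Sum>v\<in>verts G. cost k (L v)) + f \<le> (\<Sum>v\<in>verts G. weight v)"
    using feas by (auto simp: feasible_def subtree_root)
  let ?D = "{v \<in> verts G. L v = Chosen}"
  have "(\<Sum>v\<in>verts G. cost k (L v)) = (2 * int k + 1) * int (card ?D)"
    by (simp add: cost_def sum.If_cases Int_def)
  moreover have "(2 * int k + 1) * int (isolation_number k G) \<le> (2 * int k + 1) * int (card ?D)"
    using isolation_number_le[OF valid_imp_isolating[OF L(1) k]] by (intro mult_left_mono) auto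
  ultimately show ?thesis using L(2) by linarith
qed

text \<open>
  A \<open>Paid\<close> root owes \<open>1\<close>, and \<open>n + \<ell>\<close> exceeds the total weight by at least \<open>1\<close> as soon as the root
  has a child. An \<open>Above_critical\<close> root owes \<open>2\<close>, but has exactly one child, so it is itself a
  leaf of the tree and the excess is \<open>2\<close>. The other kinds owe nothing.
\<close>

lemma isolation_bound:
  assumes k: "k \<ge> 1"
  shows "(2 * k + 1) * isolation_number k G \<le> card (verts G) + leaf_order G"
proof -
  obtain t where t: "has_kind k t r" using exists_kind[OF k root_in] by blast
  define \<Phi> where "\<Phi> = (\<Sum>v\<in>verts G. weight v)"
  have bound: "(2 * int k + 1) * int (isolation_number k G) + f \<le> \<Phi>"
    if "feasible k q S r f" "q = Undominated \<or> q = Dominated" for q S f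
    unfolding \<Phi>_def using that by (intro feasible_imp_isolation_bound[OF _ k]) (auto elim: feasible_mono)
  have "(2 * int k + 1) * int (isolation_number k G) \<le> int (card (verts G)) + int (leaf_order G)"
  proof (cases "ch r = {}")
    case True
    then have "\<Phi> = 1"
      using sum_subtree[OF root_in, of weight] by (simp add: \<Phi>_def subtree_root weight_def)
    moreover have "1 \<le> card (verts G)"
      using root_in by (auto simp: Suc_le_eq card_gt_0_iff)
    ultimately show ?thesis
      using t k True by (cases t) (auto simp: has_kind_def dest!: bound)
  next
    case False
    then have "\<Phi> + 1 + (if card (ch r) = 1 then 1 else 0) = int (card (verts G)) + int (leaf_order G)"
      using sum_weight leaf_order_eq by (simp add: \<Phi>_def)
    then show ?thesis
      using t k by (cases t) (auto simp: has_kind_def split: if_splits dest!: bound)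
  qed
  then show ?thesis by (metis (mono_tags, lifting) of_nat_1 of_nat_add of_nat_le_iff of_nat_mult of_nat_numeral)
qed

end

theorem theorem4p1:
  fixes T :: "('a, 'b) pre_digraph" and k n l :: nat
  assumes "k \<ge> 2"
    and "undirected_tree T"
    and "card (verts T) = n"
    and "leaf_order T = l"
  shows "real (isolation_number k T) \<le> (real n + real l) / (2 * real k + 1)"
proof -
  interpret graph T using assms(2) by (simp add: undirected_tree_def)
  have conn: "Digraph_Component.connected T" and acyclic: "\<not> (\<exists>p. cycle p \<and> 3 \<le> length p)"
    using assms(2) by (auto simp: undirected_tree_def)
  have "verts T \<noteq> {}" using conn by (auto simp: connected_def strongly_connected_def)
  then have "1 \<le> card (verts T)" by (simp add: Suc_le_eq card_gt_0_iff)
  then obtain S r par depth where S: "S \<subseteq> verts T" "card S = card (verts T)"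
      and R: "rooted_on T S r par depth"
    using exists_rooted_subset[OF conn acyclic] by blast
  have "S = verts T" using S by (simp add: card_subset_eq)
  interpret rooted_tree "verts T" r par depth using R \<open>S = verts T\<close> by (simp add: rooted_on_def)
  interpret rooted_graph T r par depth
  proof
    fix u v
    show "u \<rightarrow>\<^bsub>T\<^esub> v \<longleftrightarrow> v \<in> ch u \<or> u \<in> ch v"
    proof (cases "u \<in> verts T \<and> v \<in> verts T")
      case True
      then show ?thesis using R \<open>S = verts T\<close> by (auto simp: rooted_on_def)
    next
      case False
      then show ?thesis using adj_in_verts[of u v] par_in by (auto simp: ch_iff)
    qed
  qed
  have "(2 * k + 1) * isolation_number k T \<le> n + l"
    using isolation_bound assms by simp
  then have "(2 * real k + 1) * real (isolation_number k T) \<le> real n + real l"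
    by (metis (mono_tags, lifting) of_nat_1 of_nat_add of_nat_le_iff of_nat_mult of_nat_numeral)
  then show ?thesis by (simp add: field_simps)
qed

end
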